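(* For every nonempty finite subset $P \subseteq \mathbb{R}^2$ there exists a constant $\epsilon > 0$ such that $\operatorname{opx}(n, P) = O(n^{2-\epsilon})$ as $n \to \infty$.
   Context: Containment for subsets of the plane: for $P, S \subseteq \mathbb{R}^2$, let $X_P, Y_P$ be the sets of $x$-coordinates and $y$-coordinates of points of $P$, and $X_S, Y_S$ likewise for $S$. $S$ contains $P$ if there exist functions $f_X: X_P \to X_S$ and $f_Y: Y_P \to Y_S$ such that (1) $\frac{f_X(x_0)-f_X(x_1)}{x_0-x_1} \ge 1$ for all $x_0 > x_1$ in $X_P$; (2) $\frac{f_Y(y_0)-f_Y(y_1)}{y_0-y_1} \ge 1$ for all $y_0 > y_1$ in $Y_P$; (3) $(f_X(x), f_Y(y)) \in S$ for all $(x,y) \in P$. Otherwise $S$ is $P$-free. For real $n > 0$, $\operatorname{opx}(n,P)$ is the supremum of the Lebesgue measure $\mu_2(S)$ over all open (in $\mathbb{R}^2$) $P$-free subsets $S \subseteq [0,n]^2$. $f(n) = O(g(n))$ means there is a constant $C > 0$ with $f(n) \le C g(n)$ for all sufficiently large $n$; here $\epsilon$ and $C$ may depend on $P$. *)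

theory Defs
  imports "HOL-Analysis.Analysis" "HOL-Library.Landau_Symbols"
begin

definition contains :: "(real \<times> real) set \<Rightarrow> (real \<times> real) set \<Rightarrow> bool" where
  "contains S P \<longleftrightarrow>
    (\<exists>fX fY.
      fX \<in> fst ` P \<rightarrow> fst ` S \<and>
      fY \<in> snd ` P \<rightarrow> snd ` S \<and>
      (\<forall>x0 \<in> fst ` P. \<forall>x1 \<in> fst ` P. x0 > x1 \<longrightarrow> (fX x0 - fX x1) / (x0 - x1) \<ge> 1) \<and>
      (\<forall>y0 \<in> snd ` P. \<forall>y1 \<in> snd ` P. y0 > y1 \<longrightarrow> (fY y0 - fY y1) / (y0 - y1) \<ge> 1) \<and>
      (\<forall>(x, y) \<in> P. (fX x, fY y) \<in> S))"

abbreviation pattern_free :: "(real \<times> real) set \<Rightarrow> (real \<times> real) set \<Rightarrow> bool" where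
  "pattern_free P S \<equiv> \<not> contains S P"

text \<open>
  The supremum is taken in the reals. It is a genuine supremum whenever P is nonempty and n > 0:
  the measures are bounded by the area of the square, and the empty set is P-free.
\<close>

definition opx :: "real \<Rightarrow> (real \<times> real) set \<Rightarrow> real" where
  "opx n P = Sup {measure lebesgue S | S. open S \<and> S \<subseteq> {0..n} \<times> {0..n} \<and> pattern_free P S}"

end

theory Submission
  imports Defs
begin

text \<open>
  Cut the square into cells of side D, where D bounds the coordinate differences of P. Averaging
  over all translates of the lattice \<open>D\<int> \<times> D\<int>\<close> yields a translate which meets S in at least
  \<open>\<mu>(S) / D\<^sup>2\<close> points. If this number is large, the Kovari-Sos-Turan argument provides a k by k
  subgrid inside S, where k = card P. Its gaps are at least D, so it contains P.
\<close>

section \<open>Grids of lattice points contain every pattern of small diameter\<close>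

lemma ex_strict_mono_on_finite:
  fixes X :: "'a::linorder set" and A :: "'b::linorder set"
  assumes "finite X" "finite A" "card X \<le> card A"
  shows "\<exists>f. f \<in> X \<rightarrow> A \<and> strict_mono_on X f"
  using assms
proof (induction X arbitrary: A rule: finite_linorder_max_induct)
  case empty
  then show ?case by (auto simp: strict_mono_on_def)
next
  case (insert b X)
  have notin: "b \<notin> X" using insert.hyps by auto
  with insert have "card A > 0" by simp
  then have "A \<noteq> {}" by auto
  then have A: "Max A \<in> A" using insert.prems by simp
  have "card X \<le> card (A - {Max A})"
    using insert.prems insert.hyps notin A by simp
  then obtain f where f: "f \<in> X \<rightarrow> A - {Max A}" "strict_mono_on X f"
    using insert.IH[of "A - {Max A}"] insert.prems by auto
  have lt: "f x < Max A" if "x \<in> X" for x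
  proof -
    have "f x \<in> A" "f x \<noteq> Max A" using f that by auto
    then show ?thesis using insert.prems by (simp add: order_le_neq_trans)
  qed
  have "f(b := Max A) \<in> insert b X \<rightarrow> A" using f A by auto
  moreover have "strict_mono_on (insert b X) (f(b := Max A))"
  proof (rule strict_mono_onI)
    fix r s assume *: "r \<in> insert b X" "s \<in> insert b X" "r < s"
    have "r \<noteq> b" using * insert.hyps(2) by auto
    then show "(f(b := Max A)) r < (f(b := Max A)) s"
      using * lt f(2) by (auto simp: strict_mono_on_def)
  qed
  ultimately show ?case by blast
qed

text \<open>Distinct points of a translate of the lattice of step \<open>D\<close> are at least
  \<open>D\<close> apart, while no two points of \<open>X\<close> are more than \<open>D\<close>
  apart. Hence any strictly increasing map between them has all slopes at least 1, and only the
  cardinalities decide whether one exists.\<close>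

lemma ex_expanding_map:
  fixes X :: "real set" and A :: "nat set"
  assumes "finite X" "finite A" "card X \<le> card A"
    and D: "\<And>x0 x1. x0 \<in> X \<Longrightarrow> x1 \<in> X \<Longrightarrow> x0 - x1 \<le> D" "D > 0"
  shows "\<exists>f. f \<in> X \<rightarrow> (\<lambda>i. D * real i + u) ` A \<and>
    (\<forall>x0\<in>X. \<forall>x1\<in>X. x0 > x1 \<longrightarrow> (f x0 - f x1) / (x0 - x1) \<ge> 1)"
proof -
  obtain g where g: "g \<in> X \<rightarrow> A" "strict_mono_on X g"
    using ex_strict_mono_on_finite[OF assms(1-3)] by blast
  define f where "f x = D * real (g x) + u" for x
  have "f \<in> X \<rightarrow> (\<lambda>i. D * real i + u) ` A" using g by (auto simp: f_def)
  moreover have "(f x0 - f x1) / (x0 - x1) \<ge> 1" if *: "x0 \<in> X" "x1 \<in> X" "x0 > x1" for x0 x1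
  proof -
    have "g x1 < g x0" using g(2) * by (auto simp: strict_mono_on_def)
    then have "D * 1 \<le> D * (real (g x0) - real (g x1))"
      using D(2) by (intro mult_left_mono) auto
    then have "D \<le> f x0 - f x1" by (simp add: f_def algebra_simps)
    then show ?thesis using * D(1)[of x0 x1] by simp
  qed
  ultimately show ?thesis by blast
qed

text \<open>\<open>S\<close> contains the whole product of the chosen columns and rows, so the two
  coordinate maps can be chosen independently of each other and of the shape of \<open>P\<close>.
  All that matters is that \<open>P\<close> has at most \<open>card P\<close> distinct coordinates
  in each direction.\<close>

lemma contains_if_lattice_grid:
  fixes A B :: "nat set"
  assumes P: "finite P" and A: "finite A" "card P \<le> card A" and B: "finite B" "card P \<le> card B"
    and D: "D > 0" "\<And>p q. p \<in> P \<Longrightarrow> q \<in> P \<Longrightarrow> fst p - fst q \<le> D"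
      "\<And>p q. p \<in> P \<Longrightarrow> q \<in> P \<Longrightarrow> snd p - snd q \<le> D"
    and S: "\<And>i j. i \<in> A \<Longrightarrow> j \<in> B \<Longrightarrow> (D * real i + u, D * real j + v) \<in> S"
  shows "contains S P"
proof -
  have X: "finite (fst ` P)" "card (fst ` P) \<le> card A"
    and Y: "finite (snd ` P)" "card (snd ` P) \<le> card B"
    using P A B card_image_le[OF P, of fst] card_image_le[OF P, of snd] by auto
  obtain f where f: "f \<in> fst ` P \<rightarrow> (\<lambda>i. D * real i + u) ` A"
    "\<forall>x0\<in>fst ` P. \<forall>x1\<in>fst ` P. x0 > x1 \<longrightarrow> (f x0 - f x1) / (x0 - x1) \<ge> 1"
    using ex_expanding_map[OF X(1) A(1) X(2) _ D(1), of u] D(2) by blast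
  obtain g where g: "g \<in> snd ` P \<rightarrow> (\<lambda>i. D * real i + v) ` B"
    "\<forall>x0\<in>snd ` P. \<forall>x1\<in>snd ` P. x0 > x1 \<longrightarrow> (g x0 - g x1) / (x0 - x1) \<ge> 1"
    using ex_expanding_map[OF Y(1) B(1) Y(2) _ D(1), of v] D(3) by blast
  have in_S: "(f x, g y) \<in> S" if "x \<in> fst ` P" "y \<in> snd ` P" for x y
  proof -
    obtain i where "i \<in> A" "f x = D * real i + u" using f(1) \<open>x \<in> fst ` P\<close> by blast
    moreover obtain j where "j \<in> B" "g y = D * real j + v" using g(1) \<open>y \<in> snd ` P\<close> by blast
    ultimately show ?thesis using S by simp
  qed
  have "f \<in> fst ` P \<rightarrow> fst ` S"
  proof
    fix x assume "x \<in> fst ` P"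
    moreover from this obtain y where "y \<in> snd ` P" by blast
    ultimately show "f x \<in> fst ` S" using in_S by (force intro: rev_image_eqI)
  qed
  moreover have "g \<in> snd ` P \<rightarrow> snd ` S"
  proof
    fix y assume "y \<in> snd ` P"
    moreover from this obtain x where "x \<in> fst ` P" by blast
    ultimately show "g y \<in> snd ` S" using in_S by (force intro: rev_image_eqI)
  qed
  moreover have "\<forall>(x, y)\<in>P. (f x, g y) \<in> S"
  proof clarify
    fix x y assume "(x, y) \<in> P"
    then have "x \<in> fst ` P" "y \<in> snd ` P" by (force intro: rev_image_eqI)+
    then show "(f x, g y) \<in> S" by (rule in_S)
  qed
  ultimately show ?thesis unfolding contains_def using f(2) g(2) by blast
qed

section \<open>The Kovari-Sos-Turan bound\<close>

text \<open>Read \<open>G\<close> as a bipartite graph and split \<open>V\<close> at degree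
  \<open>d\<close>. Vertices of degree below \<open>d\<close> account for at most
  \<open>d * card V\<close> edges. A vertex of larger degree has many \<open>k\<close>-subsets in
  its neighbourhood, but each \<open>k\<close>-subset has few common neighbours, so such vertices
  are rare. The threshold \<open>d\<close> stays free so that the two terms can be balanced
  afterwards.\<close>

lemma card_biclique_free_le:
  fixes G :: "('a \<times> 'b) set" and d :: real
  assumes U: "finite U" and V: "finite V" and G: "G \<subseteq> U \<times> V" and k: "k > 0" "real k \<le> d"
    and free: "\<And>A B. A \<subseteq> U \<Longrightarrow> B \<subseteq> V \<Longrightarrow> card A = k \<Longrightarrow> card B = k \<Longrightarrow> \<not> A \<times> B \<subseteq> G"
  shows "real (card G) \<le> d * card V + real k ^ (k + 1) * (real (card U) ^ (k + 1) / d ^ k)"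
proof -
  define nb where "nb j = {i\<in>U. (i, j) \<in> G}" for j
  define Q where "Q = {j\<in>V. d \<le> card (nb j)}"
  define \<K> where "\<K> = {K. K \<subseteq> U \<and> card K = k}"
  have fin: "finite (nb j)" "finite Q" "finite \<K>" for j
    using U V by (auto simp: nb_def Q_def \<K>_def)
  have d: "d > 0" using k by linarith
  have G_eq: "G = prod.swap ` Sigma V nb"
    using G by (force simp: nb_def)
  have "card G = card (Sigma V nb)"
    unfolding G_eq by (intro card_image inj_onI) auto
  then have card_G: "card G = (\<Sum>j\<in>V. card (nb j))"
    using V fin by simp
  have nb_le: "card (nb j) \<le> card U" for j
    using U by (intro card_mono) (auto simp: nb_def)
  have common: "card {j\<in>Q. K \<subseteq> nb j} \<le> k" if "K \<in> \<K>" for K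
  proof (rule ccontr)
    assume "\<not> ?thesis"
    \<comment> \<open>More than \<open>k\<close> common neighbours of \<open>K\<close> would leave
      room for \<open>k\<close> of them, and these form a forbidden biclique with \<open>K\<close>.
      The same argument gives \<open>k - 1\<close>, but \<open>k\<close> suffices.\<close>
    then obtain B where B: "B \<subseteq> {j\<in>Q. K \<subseteq> nb j}" "card B = k"
      by (meson nat_le_linear obtain_subset_with_card_n)
    have "K \<times> B \<subseteq> G" using B by (auto simp: nb_def)
    moreover have "B \<subseteq> V" using B by (auto simp: Q_def)
    ultimately show False using free[of K B] that B by (auto simp: \<K>_def)
  qed
  have choose_ge: "(d / k) ^ k \<le> real (card (nb j) choose k)" if "j \<in> Q" for j
  proof -
    have dj: "d \<le> card (nb j)" using that by (simp add: Q_def)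
    then have "k \<le> card (nb j)" using k by linarith
    then have "(real (card (nb j)) / k) ^ k \<le> real (card (nb j) choose k)"
      by (rule binomial_ge_n_over_k_pow_k)
    moreover have "(d / k) ^ k \<le> (real (card (nb j)) / k) ^ k"
      using dj d by (intro power_mono divide_right_mono) auto
    ultimately show ?thesis by linarith
  qed
  \<comment> \<open>Double counting of the pairs of a vertex \<open>j\<close> in \<open>Q\<close>
    and a \<open>k\<close>-subset \<open>K\<close> of its neighbourhood.\<close>
  have "(\<Sum>j\<in>Q. card (nb j) choose k) = (\<Sum>j\<in>Q. card {K\<in>\<K>. K \<subseteq> nb j})"
  proof (rule sum.cong)
    fix j
    have "{K\<in>\<K>. K \<subseteq> nb j} = {K. K \<subseteq> nb j \<and> card K = k}"
      by (auto simp: \<K>_def nb_def)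
    then show "card (nb j) choose k = card {K\<in>\<K>. K \<subseteq> nb j}"
      using n_subsets[OF fin(1)] by simp
  qed simp
  also have "\<dots> = (\<Sum>K\<in>\<K>. card {j\<in>Q. K \<subseteq> nb j})"
    by (rule sum_multicount_gen[symmetric]) (use fin in auto)
  also have "\<dots> \<le> card \<K> * k"
    using common sum_bounded_above[of \<K> "\<lambda>K. card {j\<in>Q. K \<subseteq> nb j}" k] by auto
  also have "card \<K> = card U choose k"
    unfolding \<K>_def by (rule n_subsets[OF U])
  also have "\<dots> \<le> card U ^ k"
  proof (cases "k \<le> card U")
    case True
    then show ?thesis by (rule binomial_le_pow)
  qed (simp add: binomial_eq_0)
  finally have double_count: "(\<Sum>j\<in>Q. card (nb j) choose k) \<le> card U ^ k * k" by simp
  have "card Q * (d / k) ^ k \<le> (\<Sum>j\<in>Q. real (card (nb j) choose k))"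
    using sum_bounded_below[of Q "(d / k) ^ k"] choose_ge by auto
  also have "\<dots> \<le> card U ^ k * k"
    using of_nat_mono[OF double_count, where 'a = real] by simp
  finally have Q: "card Q \<le> real k ^ (k + 1) * card U ^ k / d ^ k"
    using d k by (simp add: field_simps power_divide)
  have "real (card G) = (\<Sum>j\<in>V. real (card (nb j)))"
    unfolding card_G by simp
  \<comment> \<open>Every vertex is charged \<open>d\<close>, and those in \<open>Q\<close>
    additionally the trivial degree bound \<open>card U\<close>.\<close>
  also have "\<dots> \<le> (\<Sum>j\<in>V. d + (if j \<in> Q then real (card U) else 0))"
    using nb_le d by (intro sum_mono) (auto simp: Q_def intro: add_increasing)
  also have "\<dots> = d * card V + card Q * card U"
    using V by (simp add: sum.distrib sum.If_cases Int_absorb1 Q_def Collect_conj_eq)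
  also have "\<dots> \<le> d * card V + real k ^ (k + 1) * card U ^ k / d ^ k * card U"
    using mult_right_mono[OF Q, of "card U"] by simp
  finally show ?thesis by (simp add: mult_ac)
qed

text \<open>The choice \<open>d = m powr (k / (k + 1))\<close> makes both terms of the general bound
  the same power of \<open>m\<close>. The classical exponent is \<open>2 - 1 / k\<close>; charging
  vertices of large degree the full \<open>card U\<close> weakens it to
  \<open>2 - 1 / (k + 1)\<close>, which is still below 2.\<close>

corollary card_biclique_free_square_le:
  fixes G :: "('a \<times> 'b) set"
  assumes "finite U" "finite V" and m: "card U = m" "card V = m" and "G \<subseteq> U \<times> V" and k: "k > 0"
    and large: "real k \<le> real m powr (k / (real k + 1))"
    and free: "\<And>A B. A \<subseteq> U \<Longrightarrow> B \<subseteq> V \<Longrightarrow> card A = k \<Longrightarrow> card B = k \<Longrightarrow> \<not> A \<times> B \<subseteq> G"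
  shows "real (card G) \<le> (1 + real k ^ (k + 1)) * real m powr (2 - 1 / (real k + 1))"
proof -
  define d where "d = real m powr (k / (real k + 1))"
  \<comment> \<open>Since \<open>0 powr x = 0\<close>, the hypothesis \<open>large\<close> rules out
    \<open>m = 0\<close>.\<close>
  have m0: "real m > 0" using large k by (cases "m = 0") auto
  have "d * m = real m powr (k / (real k + 1) + 1)"
    using m0 by (simp add: d_def powr_add)
  also have "k / (real k + 1) + 1 = 2 - 1 / (real k + 1)" by (simp add: field_simps)
  finally have 1: "d * m = real m powr (2 - 1 / (real k + 1))" by (simp add: add_ac)
  have "real m ^ (k + 1) / d ^ k = real m powr real (k + 1) / real m powr (k / (real k + 1) * k)"
    using m0 powr_realpow[of "real m" "k + 1"] powr_realpow[of "real m powr (k / (real k + 1))" k]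
    by (simp only: d_def powr_powr) simp
  also have "\<dots> = real m powr (real (k + 1) - k / (real k + 1) * k)"
    by (simp add: powr_diff)
  also have "real (k + 1) - k / (real k + 1) * k = 2 - 1 / (real k + 1)" by (simp add: field_simps)
  finally have 2: "real m ^ (k + 1) / d ^ k = real m powr (2 - 1 / (real k + 1))" .
  have "real (card G) \<le> d * m + real k ^ (k + 1) * (real m ^ (k + 1) / d ^ k)"
    using card_biclique_free_le[OF assms(1,2,5) k large[folded d_def] free]
    unfolding m .
  then show ?thesis unfolding 1 2 distrib_right mult_1 .
qed

section \<open>Averaging over translates\<close>

text \<open>The averaging argument in contrapositive form: the number of \<open>a\<close> in
  \<open>I\<close> with \<open>a + p \<in> S\<close>, integrated over \<open>p\<close> in
  \<open>C\<close>, is the total measure of the pieces of \<open>S\<close> in the translates of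
  \<open>C\<close>. These cover \<open>S\<close>, so the integral is at least the measure of
  \<open>S\<close>. Only subadditivity is used, so the translates may overlap.\<close>

lemma emeasure_le_translates:
  fixes S C I :: "'a::euclidean_space set"
  assumes I: "finite I" and S: "S \<in> sets lborel" and C: "C \<in> sets lborel"
    and cover: "S \<subseteq> (\<Union>a\<in>I. (+) a ` C)"
    and bound: "\<And>p. p \<in> C \<Longrightarrow> real (card {a\<in>I. a + p \<in> S}) \<le> c"
  shows "emeasure lborel S \<le> ennreal c * emeasure lborel C"
proof -
  \<comment> \<open>The piece of \<open>S\<close> in the cell at \<open>a\<close>, moved back into
    \<open>C\<close>.\<close>
  define T where "T a = C \<inter> (+) a -` S" for a
  have T [measurable]: "T a \<in> sets lborel" for a
    unfolding T_def using S C measurable_sets_borel[of "(+) a" borel S] by auto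
  have S_eq: "S = (\<Union>a\<in>I. (+) a ` T a)"
    using cover by (fastforce simp: T_def)
  have tr: "(+) a ` T a \<in> sets lborel" "emeasure lborel ((+) a ` T a) = emeasure lborel (T a)" for a
  proof -
    \<comment> \<open>As a preimage, the translate falls under measurability of translations and
      \<open>lborel_distr_plus\<close>.\<close>
    have img: "(+) a ` T a = (+) (- a) -` T a"
    proof (intro set_eqI iffI)
      fix x assume "x \<in> (+) (- a) -` T a"
      then show "x \<in> (+) a ` T a" by (intro image_eqI[of _ _ "- a + x"]) auto
    qed auto
    show "(+) a ` T a \<in> sets lborel"
      unfolding img using T[of a] measurable_sets_borel[of "(+) (- a)" borel "T a"] by auto
    have "emeasure lborel (T a) = emeasure (distr lborel borel ((+) (- a))) (T a)"
      by (simp add: lborel_distr_plus)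
    also have "\<dots> = emeasure lborel ((+) a ` T a)"
      unfolding img using T[of a] by (subst emeasure_distr) auto
    finally show "emeasure lborel ((+) a ` T a) = emeasure lborel (T a)" ..
  qed
  have "emeasure lborel S \<le> (\<Sum>a\<in>I. emeasure lborel ((+) a ` T a))"
    by (subst S_eq, rule emeasure_subadditive_finite) (use I tr in auto)
  also have "\<dots> = (\<integral>\<^sup>+p. (\<Sum>a\<in>I. indicator (T a) p) \<partial>lborel)"
    using T by (subst nn_integral_sum) (auto simp: tr)
  also have "\<dots> \<le> (\<integral>\<^sup>+p. ennreal c * indicator C p \<partial>lborel)"
  proof (rule nn_integral_mono)
    fix p
    show "(\<Sum>a\<in>I. indicator (T a) p) \<le> ennreal c * indicator C p"
    proof (cases "p \<in> C")
      case True
      then have "(\<Sum>a\<in>I. indicator (T a) p) = (\<Sum>a\<in>I. if a + p \<in> S then 1 else 0 :: ennreal)"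
        by (intro sum.cong) (auto simp: T_def)
      also have "\<dots> = of_nat (card {a\<in>I. a + p \<in> S})"
        using I by (simp add: sum.If_cases Collect_conj_eq)
      also have "\<dots> \<le> ennreal c"
        using bound[OF True] by (simp add: ennreal_leI flip: ennreal_of_nat_eq_real_of_nat)
      finally show ?thesis using True by simp
    qed (simp add: T_def)
  qed
  also have "\<dots> = ennreal c * emeasure lborel C"
    using C by (subst nn_integral_cmult_indicator) auto
  finally show ?thesis .
qed

section \<open>The area bound for pattern-free sets\<close>

text \<open>For each shift \<open>p\<close>, the lattice points that land in \<open>S\<close> form a
  bipartite graph on column and row indices. A \<open>k\<close> by \<open>k\<close> biclique in it
  would be a grid containing \<open>P\<close>, so the graph bound limits the count for every shift,
  and averaging over one cell of area \<open>D\<^sup>2\<close> gives the claim. The condition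
  \<open>n < D * real m\<close> lets \<open>m\<close> cells per side cover the square.\<close>

lemma measure_pattern_free_le:
  fixes P S :: "(real \<times> real) set"
  assumes P: "finite P" "P \<noteq> {}" and D: "D > 0"
    "\<And>p q. p \<in> P \<Longrightarrow> q \<in> P \<Longrightarrow> fst p - fst q \<le> D"
    "\<And>p q. p \<in> P \<Longrightarrow> q \<in> P \<Longrightarrow> snd p - snd q \<le> D"
    and S: "open S" "S \<subseteq> {0..n} \<times> {0..n}" "pattern_free P S"
    and k: "k = card P" and m: "n < D * real m"
    and large: "real k \<le> real m powr (k / (real k + 1))"
  shows "measure lebesgue S \<le> (1 + real k ^ (k + 1)) * real m powr (2 - 1 / (real k + 1)) * D\<^sup>2"
proof -
  define c where "c = (1 + real k ^ (k + 1)) * real m powr (2 - 1 / (real k + 1))"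
  define \<phi> where "\<phi> = (\<lambda>(i::nat, j::nat). (D * real i, D * real j))"
  define I where "I = \<phi> ` ({..<m} \<times> {..<m})"
  \<comment> \<open>Closed cells share edges, which is harmless because
    \<open>emeasure_le_translates\<close> does not ask for disjointness.\<close>
  define C where "C = cbox (0::real, 0::real) (D, D)"
  have k0: "k > 0" using P k by (simp add: card_gt_0_iff)
  have inj: "inj \<phi>" using D(1) by (auto simp: \<phi>_def inj_on_def)
  have c0: "c \<ge> 0" unfolding c_def by simp
  have cell: "\<exists>i<m. D * real i \<le> x \<and> x - D * real i \<le> D" if "0 \<le> x" "x \<le> n" for x
  proof (intro exI conjI)
    define i where "i = nat \<lfloor>x / D\<rfloor>"
    have i: "real i \<le> x / D" "x / D < real i + 1" using that D(1) by (auto simp: i_def)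
    have "x / D < m" using that m D(1) by (simp add: field_simps)
    then show "i < m" using i by linarith
    show "D * real i \<le> x" "x - D * real i \<le> D" using i D(1) by (auto simp: field_simps)
  qed
  have cover: "S \<subseteq> (\<Union>a\<in>I. (+) a ` C)"
  proof
    fix p assume "p \<in> S"
    then obtain x y where p: "p = (x, y)" "0 \<le> x" "x \<le> n" "0 \<le> y" "y \<le> n"
      using S(2) by (cases p) auto
    obtain i j where "i < m" "D * real i \<le> x" "x - D * real i \<le> D"
      and "j < m" "D * real j \<le> y" "y - D * real j \<le> D"
      using cell p by meson
    then have "\<phi> (i, j) \<in> I" "p = \<phi> (i, j) + (x - D * real i, y - D * real j)"
      "(x - D * real i, y - D * real j) \<in> C"
      by (auto simp: I_def C_def \<phi>_def p(1) cbox_Pair_eq)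
    then show "p \<in> (\<Union>a\<in>I. (+) a ` C)" by blast
  qed
  have bound: "real (card {a\<in>I. a + p \<in> S}) \<le> c" for p
  proof -
    define G where "G = {z \<in> {..<m} \<times> {..<m}. \<phi> z + p \<in> S}"
    have "{a\<in>I. a + p \<in> S} = \<phi> ` G" by (auto simp: I_def G_def)
    then have "card {a\<in>I. a + p \<in> S} = card G"
      using inj by (simp add: card_image inj_on_subset)
    also have "real (card G) \<le> c"
      unfolding c_def
    proof (rule card_biclique_free_square_le[of "{..<m}" "{..<m}"])
      fix A B :: "nat set"
      assume AB: "A \<subseteq> {..<m}" "B \<subseteq> {..<m}" "card A = k" "card B = k"
      show "\<not> A \<times> B \<subseteq> G"
      proof
        assume "A \<times> B \<subseteq> G"
        then have grid: "(D * real i + fst p, D * real j + snd p) \<in> S" if "i \<in> A" "j \<in> B" for i j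
          using that by (cases p) (auto simp: G_def \<phi>_def)
        moreover have "finite A" "finite B" using AB finite_subset by blast+
        ultimately have "contains S P"
          using contains_if_lattice_grid[OF P(1) _ _ _ _ D grid] AB k by simp
        then show False using S by simp
      qed
    qed (use k0 large in \<open>auto simp: G_def\<close>)
    finally show ?thesis .
  qed
  have "emeasure lborel S \<le> ennreal c * emeasure lborel C"
    by (rule emeasure_le_translates[of I])
      (use cover bound S(1) in \<open>auto simp: I_def C_def\<close>)
  also have "emeasure lborel C = ennreal (D\<^sup>2)"
    using D(1) by (simp add: C_def emeasure_lborel_cbox_eq Basis_prod_def power2_eq_square)
  also have "ennreal c * ennreal (D\<^sup>2) = ennreal (c * D\<^sup>2)"
    using c0 by (simp add: ennreal_mult)
  finally have "measure lborel S \<le> c * D\<^sup>2"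
    using c0 by (simp add: measure_def enn2real_leI)
  \<comment> \<open>\<open>S\<close> is open, hence Borel, and on Borel sets \<open>lebesgue\<close>
    and \<open>lborel\<close> agree.\<close>
  then show ?thesis using S(1) by (simp add: c_def)
qed

theorem corollary3p6:
  fixes P :: "(real \<times> real) set"
  assumes "finite P" and "P \<noteq> {}"
  shows "\<exists>\<epsilon>::real. \<epsilon> > 0 \<and> (\<lambda>n::real. opx n P) \<in> O[at_top](\<lambda>n. n powr (2 - \<epsilon>))"
proof (intro exI conjI)
  define k where "k = card P"
  have k0: "k > 0" using assms by (simp add: k_def card_gt_0_iff)
  show "0 < 1 / (real k + 1)" by simp
  \<comment> \<open>The summand 1 keeps \<open>D\<close> positive when \<open>P\<close> is a single
    point.\<close>
  define D where "D = 1 + diameter P"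
  have D0: "D > 0" using diameter_ge_0[OF finite_imp_bounded[OF assms(1)]] by (simp add: D_def)
  have dist_le: "dist p q \<le> D" if "p \<in> P" "q \<in> P" for p q
    using diameter_bounded_bound[OF finite_imp_bounded[OF assms(1)] that] by (simp add: D_def)
  have D: "fst p - fst q \<le> D" "snd p - snd q \<le> D" if "p \<in> P" "q \<in> P" for p q
    using dist_le[OF that] dist_fst_le[of p q] dist_snd_le[of p q] by (auto simp: dist_real_def)
  define e where "e = 2 - 1 / (real k + 1)"
  \<comment> \<open>The area bound with \<open>m\<close> replaced by \<open>2 / D * n\<close>, the
    power of \<open>n\<close> split off.\<close>
  define K where "K = (1 + real k ^ (k + 1)) * (2 / D) powr e * D\<^sup>2"
  have e0: "e \<ge> 0" by (simp add: e_def field_simps)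
  show "(\<lambda>n. opx n P) \<in> O(\<lambda>n. n powr (2 - 1 / (real k + 1)))"
  proof (rule bigoI)
    show "\<forall>\<^sub>F n in at_top. norm (opx n P) \<le> K * norm (n powr (2 - 1 / (real k + 1)))"
      \<comment> \<open>The first threshold gives \<open>m \<le> n / D + 1 \<le> 2 / D * n\<close>.
        The second is \<open>real k \<le> (n / D) powr (k / (real k + 1))\<close> solved for
        \<open>n\<close>, and yields \<open>large\<close>.\<close>
      using eventually_ge_at_top[of D] eventually_ge_at_top[of "D * real k powr ((real k + 1) / k)"]
    proof eventually_elim
      case (elim n)
      \<comment> \<open>The successor makes \<open>n < D * real m\<close> strict even when
        \<open>n / D\<close> is an integer.\<close>
      define m where "m = Suc (nat \<lfloor>n / D\<rfloor>)"
      have nD: "n / D \<ge> 1" using elim D0 by simp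
      have m: "n / D < m" "m \<le> n / D + 1" using nD unfolding m_def by linarith+
      have "real k = (real k powr ((real k + 1) / k)) powr (k / (real k + 1))"
        using k0 by (simp add: powr_powr)
      also have "\<dots> \<le> real m powr (k / (real k + 1))"
      proof (rule powr_mono2)
        have "real k powr ((real k + 1) / k) \<le> n / D" using elim D0 by (simp add: field_simps)
        then show "real k powr ((real k + 1) / k) \<le> real m" using m by linarith
      qed auto
      finally have large: "real k \<le> real m powr (k / (real k + 1))" .
      have "real m powr e \<le> (2 / D * n) powr e"
        using m nD e0 by (intro powr_mono2) auto
      also have "\<dots> = (2 / D) powr e * n powr e"
        using D0 elim powr_mult[of "2 / D" n e] by simp
      finally have "(1 + real k ^ (k + 1)) * real m powr e * D\<^sup>2
          \<le> (1 + real k ^ (k + 1)) * ((2 / D) powr e * n powr e) * D\<^sup>2"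
        by (intro mult_right_mono mult_left_mono) auto
      then have Km: "(1 + real k ^ (k + 1)) * real m powr e * D\<^sup>2 \<le> K * n powr e"
        by (simp add: K_def mult_ac)
      define M where "M = {measure lebesgue S |S. open S \<and> S \<subseteq> {0..n} \<times> {0..n} \<and> pattern_free P S}"
      have bound: "x \<le> K * n powr e" if x: "x \<in> M" for x
      proof -
        obtain S where "x = measure lebesgue S" "open S" "S \<subseteq> {0..n} \<times> {0..n}" "pattern_free P S"
          using x by (auto simp: M_def)
        then have "x \<le> (1 + real k ^ (k + 1)) * real m powr e * D\<^sup>2"
          using measure_pattern_free_le[of P D S n k m] assms D0 D m large
          by (simp add: k_def e_def field_simps)
        then show ?thesis using Km by linarith
      qed
      \<comment> \<open>The empty set puts 0 into \<open>M\<close>. So \<open>M\<close> is nonempty,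
        as \<open>cSup_least\<close> requires, and its supremum is nonnegative, which removes the
        norm.\<close>
      have "pattern_free P {}" using assms(2) by (auto simp: contains_def)
      then have zero: "0 \<in> M" by (auto simp: M_def intro!: exI[of _ "{}"])
      have "Sup M \<le> K * n powr e" using bound zero by (intro cSup_least) auto
      moreover have "0 \<le> Sup M" using bound zero by (intro cSup_upper bdd_aboveI)
      ultimately show ?case by (simp add: opx_def M_def e_def)
    qed
  qed
qed

end
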